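(* Let $G$ be a graph and let $F_k(G)$ be its $k$-token graph. Then the Laplacian spectrum of $G$ is contained in the Laplacian spectrum of $F_k(G)$.
   Context: All graphs are finite and simple. For a graph $G$ with vertex set $[n]=\{1,\dots,n\}$ and a given integer $k$ with $1\le k\le n$, the $k$-token graph $F_k(G)$ has as vertices the $\binom{n}{k}$ $k$-subsets of $[n]$; two vertices $A,B$ are adjacent whenever their symmetric difference $A\bigtriangleup B$ is a pair $\{a,b\}$ with $a\in A$, $b\in B$ and $\{a,b\}$ an edge of $G$. The Laplacian matrix of a graph is $L=D-A$, with $A$ the adjacency matrix and $D$ the diagonal matrix of vertex degrees. The Laplacian spectrum of a graph is the multiset of eigenvalues of its Laplacian matrix, counted with multiplicity, and containment of spectra means containment of multisets.
   Formalization: The case k = n with n ≥ 2 is excluded: there the k-token graph is a single vertex with spectrum {0}, while G has n ≥ 2 Laplacian eigenvalues, so the containment fails; all other 1 ≤ k ≤ n are covered. *)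

theory Defs
  imports "Graph_Theory.Pair_Digraph" "Jordan_Normal_Form.Char_Poly"
begin

text \<open>
  Finite simple graphs are the \<open>pair_graph\<close>s of Graph_Theory: finite, symmetric and loop-free
  sets of arcs, so that an edge \<open>{a, b}\<close> is represented by the two arcs \<open>(a, b)\<close> and \<open>(b, a)\<close>.
\<close>

definition token_graph :: "nat \<Rightarrow> 'a pair_pre_digraph \<Rightarrow> 'a set pair_pre_digraph" where
  "token_graph k G =
    \<lparr> pverts = {A. A \<subseteq> pverts G \<and> card A = k},
      parcs = {(A, B). A \<subseteq> pverts G \<and> card A = k \<and> B \<subseteq> pverts G \<and> card B = k \<and>
        (\<exists>a\<in>A. \<exists>b\<in>B. sym_diff A B = {a, b} \<and> (a, b) \<in> parcs G)} \<rparr>"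

text \<open>
  Matrices have index set \<open>{0..<dim}\<close>, so the matrices of a graph depend on a list \<open>vs\<close> that
  enumerates its vertices without repetition. Each edge at \<open>v\<close> contributes exactly one arc with
  tail \<open>v\<close>, so the out-degree is the usual degree.
\<close>

definition adjacency_mat :: "'a pair_pre_digraph \<Rightarrow> 'a list \<Rightarrow> real mat" where
  "adjacency_mat G vs = mat (length vs) (length vs)
    (\<lambda>(i, j). if (vs ! i, vs ! j) \<in> parcs G then 1 else 0)"

definition degree_mat :: "'a pair_pre_digraph \<Rightarrow> 'a list \<Rightarrow> real mat" where
  "degree_mat G vs = mat (length vs) (length vs)
    (\<lambda>(i, j). if i = j then real (out_degree (with_proj G) (vs ! i)) else 0)"

definition laplacian_mat :: "'a pair_pre_digraph \<Rightarrow> 'a list \<Rightarrow> real mat" where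
  "laplacian_mat G vs = degree_mat G vs - adjacency_mat G vs"

text \<open>
  Eigenvalues counted with multiplicity are the roots of the characteristic polynomial, taken over
  the complex numbers so that no eigenvalue is left out by definition.
\<close>

definition mat_spectrum :: "real mat \<Rightarrow> complex multiset" where
  "mat_spectrum M = proots (char_poly (map_mat complex_of_real M))"

definition laplacian_spectrum :: "'a pair_pre_digraph \<Rightarrow> complex multiset" where
  "laplacian_spectrum G =
    mat_spectrum (laplacian_mat G (SOME vs. distinct vs \<and> set vs = pverts G))"

lemma pair_graph_token_graph:
  assumes "pair_graph G"
  shows "pair_graph (token_graph k G)"
proof -
  interpret pair_graph G by fact
  have sy: "(b, a) \<in> parcs G" if "(a, b) \<in> parcs G" for a b
    using that pair_sym_arcs by (auto simp: symmetric_def dest: symD)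
  have fv: "finite {A. A \<subseteq> pverts G \<and> card A = k}"
    using pair_finite_verts by simp
  have sub: "parcs (token_graph k G) \<subseteq> pverts (token_graph k G) \<times> pverts (token_graph k G)"
    by (auto simp: token_graph_def)
  have fin: "finite (parcs (token_graph k G))"
    by (rule finite_subset[OF sub]) (use fv in \<open>auto simp: token_graph_def\<close>)
  have "sym (parcs (token_graph k G))"
  proof (rule symI)
    fix A B assume "(A, B) \<in> parcs (token_graph k G)"
    then obtain a b where *: "A \<subseteq> pverts G" "card A = k" "B \<subseteq> pverts G" "card B = k"
      "a \<in> A" "b \<in> B" "sym_diff A B = {a, b}" "(a, b) \<in> parcs G"
      by (auto simp: token_graph_def)
    moreover have "sym_diff B A = {b, a}" using *(7) by (metis Un_commute insert_commute)
    ultimately have "\<exists>b\<in>B. \<exists>a\<in>A. sym_diff B A = {b, a} \<and> (b, a) \<in> parcs G"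
      using sy by (intro bexI[of _ b] bexI[of _ a] conjI)
    with * show "(B, A) \<in> parcs (token_graph k G)"
      unfolding token_graph_def by simp
  qed
  moreover have "fst e \<noteq> snd e" if "e \<in> parcs (token_graph k G)" for e
  proof
    assume eq: "fst e = snd e"
    from that obtain a b where "sym_diff (fst e) (snd e) = {a, b}"
      unfolding token_graph_def by fastforce
    thus False unfolding eq by simp
  qed
  moreover have "finite (pverts (token_graph k G))"
    using fv by (simp add: token_graph_def)
  moreover have "fst e \<in> pverts (token_graph k G)" "snd e \<in> pverts (token_graph k G)"
    if "e \<in> parcs (token_graph k G)" for e
    using subsetD[OF sub that] by (auto simp: mem_Times_iff)
  ultimately show ?thesis
    using fin by unfold_locales (simp_all add: symmetric_def)
qed

text \<open>The chosen enumeration is irrelevant.\<close>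

lemma laplacian_spectrum_eq:
  assumes vs: "distinct vs" "set vs = pverts G"
  shows "laplacian_spectrum G = mat_spectrum (laplacian_mat G vs)"
proof -
  define ws where "ws = (SOME vs. distinct vs \<and> set vs = pverts G)"
  have ws: "distinct ws" "set ws = pverts G"
    using someI[of "\<lambda>vs. distinct vs \<and> set vs = pverts G" vs] vs unfolding ws_def by auto
  define n where "n = length vs"
  have len: "length vs = n" "length ws = n"
    using vs ws distinct_card[of vs] distinct_card[of ws] by (auto simp: n_def)
  define L where "L xs = map_mat complex_of_real (laplacian_mat G xs)" for xs
  define f :: "'a \<Rightarrow> 'a \<Rightarrow> complex" where
    "f u v = (if u = v then of_nat (out_degree (with_proj G) u) else 0)
             - (if (u, v) \<in> parcs G then 1 else 0)" for u v
  have L: "L xs = mat n n (\<lambda>(i, j). f (xs ! i) (xs ! j))" if "length xs = n" "distinct xs" for xs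
    using that by (intro eq_matI) (auto simp: L_def laplacian_mat_def degree_mat_def
        adjacency_mat_def f_def nth_eq_iff_index_eq)
  define Q :: "'a list \<Rightarrow> 'a list \<Rightarrow> complex mat" where
    "Q xs ys = mat n n (\<lambda>(i, j). if xs ! i = ys ! j then 1 else 0)" for xs ys
  have reindex: "(\<Sum>k = 0..<n. h (xs ! k)) = (\<Sum>v\<in>pverts G. h v)"
    if "length xs = n" "distinct xs" "set xs = pverts G" for h :: "'a \<Rightarrow> complex" and xs
    using that
    by (intro sum.reindex_bij_betw) (auto simp: atLeast0LessThan intro!: bij_betw_nth)
  have fin: "finite (pverts G)" using vs by (metis List.finite_set)
  have mem: "xs ! i \<in> pverts G" if "length xs = n" "set xs = pverts G" "i < n" for xs i
    using that by (metis nth_mem)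
  have QQ: "Q xs ys * Q ys xs = 1\<^sub>m n"
    if "length xs = n" "distinct xs" "set xs = pverts G"
       "length ys = n" "distinct ys" "set ys = pverts G" for xs ys
  proof (rule eq_matI)
    fix i j assume ij: "i < dim_row (1\<^sub>m n :: complex mat)" "j < dim_col (1\<^sub>m n :: complex mat)"
    have "(Q xs ys * Q ys xs) $$ (i, j) =
      (\<Sum>k = 0..<n. (\<lambda>v. (if xs ! i = v then 1 else 0) * (if v = xs ! j then 1 else 0)) (ys ! k))"
      using ij by (simp add: Q_def scalar_prod_def)
    also have "\<dots> = (\<Sum>v\<in>pverts G. (if xs ! i = v then 1 else 0) * (if v = xs ! j then 1 else 0))"
      using that by (subst reindex) auto
    also have "\<dots> = (\<Sum>v\<in>pverts G. if xs ! i = v then (if xs ! i = xs ! j then 1 else 0) else 0)"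
      by (intro sum.cong) auto
    also have "\<dots> = (1\<^sub>m n :: complex mat) $$ (i, j)"
      using ij that mem fin by (simp add: nth_eq_iff_index_eq)
    finally show "(Q xs ys * Q ys xs) $$ (i, j) = (1\<^sub>m n :: complex mat) $$ (i, j)" .
  qed (auto simp: Q_def)
  have LQ: "Q ws vs * L vs = mat n n (\<lambda>(i, j). f (ws ! i) (vs ! j))"
  proof (rule eq_matI)
    fix i j assume ij: "i < dim_row (mat n n (\<lambda>(i, j). f (ws ! i) (vs ! j)))"
      "j < dim_col (mat n n (\<lambda>(i, j). f (ws ! i) (vs ! j)))"
    have "(Q ws vs * L vs) $$ (i, j) =
      (\<Sum>k = 0..<n. (\<lambda>v. (if ws ! i = v then 1 else 0) * f v (vs ! j)) (vs ! k))"
      using ij vs len by (simp add: Q_def scalar_prod_def L)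
    also have "\<dots> = (\<Sum>v\<in>pverts G. (if ws ! i = v then 1 else 0) * f v (vs ! j))"
      using vs len by (subst reindex) auto
    also have "\<dots> = (\<Sum>v\<in>pverts G. if ws ! i = v then f (ws ! i) (vs ! j) else 0)"
      by (intro sum.cong) auto
    also have "\<dots> = f (ws ! i) (vs ! j)"
      using ij ws len mem fin by simp
    finally show "(Q ws vs * L vs) $$ (i, j) = mat n n (\<lambda>(i, j). f (ws ! i) (vs ! j)) $$ (i, j)"
      using ij by simp
  qed (use vs len in \<open>auto simp: Q_def L\<close>)
  have "Q ws vs * L vs * Q vs ws = L ws"
  proof (rule eq_matI)
    fix i j assume ij: "i < dim_row (L ws)" "j < dim_col (L ws)"
    hence ij': "i < n" "j < n" using ws len by (auto simp: L)
    have "(Q ws vs * L vs * Q vs ws) $$ (i, j) =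
      (\<Sum>k = 0..<n. (\<lambda>v. f (ws ! i) v * (if v = ws ! j then 1 else 0)) (vs ! k))"
      using ij' by (simp add: LQ) (simp add: Q_def scalar_prod_def)
    also have "\<dots> = (\<Sum>v\<in>pverts G. f (ws ! i) v * (if v = ws ! j then 1 else 0))"
      using vs len by (subst reindex) auto
    also have "\<dots> = (\<Sum>v\<in>pverts G. if v = ws ! j then f (ws ! i) (ws ! j) else 0)"
      by (intro sum.cong) auto
    also have "\<dots> = L ws $$ (i, j)"
      using ij' ws len mem fin by (simp add: L)
    finally show "(Q ws vs * L vs * Q vs ws) $$ (i, j) = L ws $$ (i, j)" .
  qed (use ws vs len in \<open>auto simp: Q_def L\<close>)
  moreover have "{L ws, L vs, Q ws vs, Q vs ws} \<subseteq> carrier_mat n n"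
    using L[of vs] L[of ws] vs ws len by (simp add: Q_def)
  ultimately have "similar_mat (L ws) (L vs)"
    using QQ[of ws vs] QQ[of vs ws] vs ws len by (metis similar_matI)
  from char_poly_similar[OF this] show ?thesis
    unfolding laplacian_spectrum_def mat_spectrum_def ws_def[symmetric] L_def by simp
qed

end

theory Submission
  imports Defs
begin

text \<open>
  Let \<open>B\<close> be the incidence matrix between \<open>k\<close>-subsets and vertices, \<open>B(A, v) = 1\<close> iff \<open>v \<in> A\<close>.
  It intertwines the two Laplacians, \<open>L(F\<^sub>k(G)) * B = B * L(G)\<close>: at \<open>(A, v)\<close> both sides count the
  edges at \<open>v\<close> that cross the boundary of \<open>A\<close>, with sign \<open>+\<close> if \<open>v \<in> A\<close> and \<open>-\<close> otherwise. Unless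
  \<open>k = n \<ge> 2\<close>, \<open>B\<close> has a left inverse whose entry at \<open>(u, A)\<close> depends only on whether \<open>u \<in> A\<close>.
  So \<open>L(G)\<close> is the restriction of \<open>L(F\<^sub>k(G))\<close> to an invariant subspace, and its characteristic
  polynomial divides the other one.
\<close>

section \<open>Characteristic polynomials of intertwined matrices\<close>

lemma char_poly_four_block_zero_upper_right:
  fixes A D :: "'a :: idom mat"
  assumes A: "A \<in> carrier_mat n n" and C: "C \<in> carrier_mat m n" and D: "D \<in> carrier_mat m m"
  shows "char_poly (four_block_mat A (0\<^sub>m n m) C D) = char_poly A * char_poly D"
proof -
  have "char_poly_matrix (four_block_mat A (0\<^sub>m n m) C D) =
      four_block_mat (char_poly_matrix A) (0\<^sub>m n m) (map_mat (\<lambda>a. [:- a:]) C) (char_poly_matrix D)"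
    using A C D by (intro eq_matI) (auto simp: char_poly_matrix_def)
  moreover have "det \<dots> = det (char_poly_matrix A) * det (char_poly_matrix D)"
    using A C D by (intro det_four_block_mat_upper_right_zero[of _ n _ m]) auto
  ultimately show ?thesis by (simp add: char_poly_def)
qed

lemma char_poly_smult_one: "char_poly (c \<cdot>\<^sub>m 1\<^sub>m n :: 'a :: comm_ring_1 mat) = [:- c, 1:] ^ n"
proof -
  have "char_poly (c \<cdot>\<^sub>m 1\<^sub>m n :: 'a mat) = (\<Prod>a\<leftarrow>diag_mat (c \<cdot>\<^sub>m 1\<^sub>m n). [:- a, 1:])"
    by (rule char_poly_upper_triangular[of _ n]) auto
  also have "diag_mat (c \<cdot>\<^sub>m 1\<^sub>m n :: 'a mat) = replicate n c"
    by (rule nth_equalityI) (auto simp: diag_mat_def)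
  finally show ?thesis by simp
qed

lemma char_poly_nonzero:
  "(A :: 'a :: comm_ring_1 mat) \<in> carrier_mat n n \<Longrightarrow> char_poly A \<noteq> 0"
  using degree_monic_char_poly[of A n] by auto

text \<open>\<open>Z\<close> pads \<open>M\<close> to size \<open>N + n\<close>, which leaves room
  for a change of basis by explicit blocks. It is left arbitrary so that its eigenvalues can later
  be chosen away from those of \<open>L\<close>.\<close>

lemma char_poly_mult_of_intertwining:
  fixes M L :: "'a :: idom mat"
  assumes M: "M \<in> carrier_mat N N" and L: "L \<in> carrier_mat n n"
    and B: "B \<in> carrier_mat N n" and X: "X \<in> carrier_mat n N" and Z: "Z \<in> carrier_mat n n"
    and XB: "X * B = 1\<^sub>m n" and MB: "M * B = B * L"
  shows "\<exists>K \<in> carrier_mat N N. char_poly M * char_poly Z = char_poly K * char_poly L"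
proof -
  \<comment> \<open>\<open>U\<close> is an involution that exchanges the range of \<open>B\<close> with the added summand of dimension \<open>n\<close>,
    so conjugating \<open>diag(M, Z)\<close> by it exposes \<open>L\<close> as a diagonal block without completing the
    columns of \<open>B\<close> to a basis.\<close>
  define P where "P = 1\<^sub>m N - B * X"
  define U where "U = four_block_mat P B X (0\<^sub>m n n)"
  define T where "T = four_block_mat M (0\<^sub>m N n) (0\<^sub>m n N) Z"
  define K where "K = P * M * P + B * Z * X"
  have P: "P \<in> carrier_mat N N" and BX: "B * X \<in> carrier_mat N N"
    using B X by (auto simp: P_def)
  \<comment> \<open>\<open>B * X\<close> projects onto the range of \<open>B\<close> and
    \<open>P\<close> is the complementary projection. \<open>PB\<close>, \<open>XP\<close>,
    \<open>PP\<close> and \<open>XB\<close> are the four blocks of \<open>U * U = 1\<close>.\<close>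
  have PB: "P * B = 0\<^sub>m N n"
    unfolding P_def using B X XB
    by (simp add: minus_mult_distrib_mat[of _ N N _ _ n] assoc_mult_mat[of B N n X N B n])
  have XP: "X * P = 0\<^sub>m n N"
    unfolding P_def using B X XB
    by (simp add: mult_minus_distrib_mat[of _ n N _ N] assoc_mult_mat[of X n N B n X N, symmetric])
  have "P * P = P * 1\<^sub>m N - P * B * X"
    using B X P by (subst (2) P_def)
      (simp add: mult_minus_distrib_mat[of _ N N _ N] assoc_mult_mat[of P N N B n X N])
  hence PP: "P * P + B * X = 1\<^sub>m N"
    using P PB X B BX by (auto simp: P_def intro!: eq_matI)
  \<comment> \<open>\<open>M\<close> maps the range of \<open>B\<close> into itself and
    \<open>P\<close> kills that range. This is the zero block that makes \<open>U * T * U\<close>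
    block triangular; \<open>XMB\<close> gives its diagonal block \<open>L\<close>.\<close>
  have PMB: "P * M * B = 0\<^sub>m N n"
    using P M B L by (simp add: assoc_mult_mat[of P N N M N B n] MB
        assoc_mult_mat[of P N N B n L n, symmetric] PB)
  have XMB: "X * M * B = L"
    using X M B L by (simp add: assoc_mult_mat[of X n N M N B n] MB
        assoc_mult_mat[of X n N B n L n, symmetric] XB)
  have K: "K \<in> carrier_mat N N" using P M B X Z by (simp add: K_def)
  have carr: "U \<in> carrier_mat (N + n) (N + n)" "T \<in> carrier_mat (N + n) (N + n)"
    using P M Z by (auto simp: U_def T_def)
  have UU: "U * U = 1\<^sub>m (N + n)"
    using P B X BX PP PB XP XB
    by (simp add: U_def mult_four_block_mat[of _ N N _ n _ n _ _ N _ n])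
  have "U * T = four_block_mat (P * M) (B * Z) (X * M) (0\<^sub>m n n)"
    using P B X M Z
    by (simp add: U_def T_def mult_four_block_mat[of _ N N _ n _ n _ _ N _ n])
  hence "U * T * U = four_block_mat K (0\<^sub>m N n) (X * M * P) L"
    using P B X M Z L PMB XMB
    by (simp add: U_def K_def mult_four_block_mat[of _ N N _ n _ n _ _ N _ n])
  hence "similar_mat (four_block_mat K (0\<^sub>m N n) (X * M * P) L) T"
    using carr UU four_block_carrier_mat[OF K L]
    by (intro similar_matI[of _ _ U U "N + n"]) simp_all
  hence "char_poly (four_block_mat K (0\<^sub>m N n) (X * M * P) L) = char_poly T"
    by (rule char_poly_similar)
  hence "char_poly M * char_poly Z = char_poly K * char_poly L"
    using X M P L Z K
    by (simp add: T_def char_poly_four_block_zero_upper_right[of _ N _ n])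
  with K show ?thesis by blast
qed

lemma proots_char_poly_subset_of_intertwining:
  fixes M L :: "'a :: field_char_0 mat"
  assumes M: "M \<in> carrier_mat N N" and L: "L \<in> carrier_mat n n"
    and B: "B \<in> carrier_mat N n" and X: "X \<in> carrier_mat n N"
    and XB: "X * B = 1\<^sub>m n" and MB: "M * B = B * L"
  shows "proots (char_poly L) \<subseteq># proots (char_poly M)"
proof -
  have nz: "char_poly M \<noteq> 0" "char_poly L \<noteq> 0"
    using char_poly_nonzero M L by auto
  \<comment> \<open>With \<open>Z = c I\<close> and \<open>c\<close> not an eigenvalue of \<open>L\<close>, the factor \<open>(x - c)^n\<close> contributes nothing
    to the multiplicities of the roots of \<open>char_poly L\<close>.\<close>
  from poly_roots_finite[OF nz(2)] obtain c where c: "poly (char_poly L) c \<noteq> 0"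
    using ex_new_if_finite[OF infinite_UNIV_char_0] by blast
  obtain K where K: "K \<in> carrier_mat N N"
    and eq: "char_poly M * [:- c, 1:] ^ n = char_poly K * char_poly L"
    using char_poly_mult_of_intertwining[OF M L B X _ XB MB, of "c \<cdot>\<^sub>m 1\<^sub>m n"]
    by (auto simp: char_poly_smult_one)
  have nzK: "char_poly K \<noteq> 0" using char_poly_nonzero K by auto
  show ?thesis
  proof (rule mset_subset_eqI)
    fix a
    show "count (proots (char_poly L)) a \<le> count (proots (char_poly M)) a"
    proof (cases "a = c")
      case True
      thus ?thesis using c nz by (simp add: order_root)
    next
      case False
      have "order a (char_poly L) \<le> order a (char_poly K * char_poly L)"
        using nz nzK by (simp add: order_mult)
      also have "\<dots> = order a (char_poly M) + order a ([:- c, 1:] ^ n)"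
        using nz by (simp flip: eq add: order_mult)
      also have "order a ([:- c, 1:] ^ n) = 0"
        using False by (intro order_0I) auto
      finally show ?thesis using nz by simp
    qed
  qed
qed

section \<open>From matrices to sums over vertices\<close>

definition laplacian :: "'a pair_pre_digraph \<Rightarrow> 'a \<Rightarrow> 'a \<Rightarrow> complex" where
  "laplacian G u v = (if u = v then of_nat (card {w. (u, w) \<in> parcs G}) else 0)
    - (if (u, v) \<in> parcs G then 1 else 0)"

lemma out_degree_with_proj: "out_degree (with_proj G) u = card {w. (u, w) \<in> parcs G}"
proof -
  have "out_arcs (with_proj G) u = Pair u ` {w. (u, w) \<in> parcs G}"
    by (auto simp: out_arcs_def)
  thus ?thesis by (simp add: out_degree_def card_image inj_on_def)
qed

lemma map_laplacian_mat:
  assumes "distinct vs"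
  shows "map_mat complex_of_real (laplacian_mat G vs) =
    mat (length vs) (length vs) (\<lambda>(i, j). laplacian G (vs ! i) (vs ! j))"
  using assms by (intro eq_matI) (auto simp: laplacian_mat_def degree_mat_def adjacency_mat_def
      laplacian_def out_degree_with_proj nth_eq_iff_index_eq)

lemma sum_nth_distinct:
  assumes "distinct xs"
  shows "(\<Sum>i = 0..<length xs. h (xs ! i)) = (\<Sum>x\<in>set xs. h x)"
  using assms by (simp add: sum.distinct_set_conv_list sum_list_sum_nth)

text \<open>Removes the vertex enumerations once and for all: \<phi> and \<psi> are the entries of
  \<open>B\<close> and of its left inverse \<open>X\<close>, so that only identities between sums
  over vertices remain to be checked.\<close>

lemma laplacian_spectrum_subset_of_intertwining:
  fixes G :: "'a pair_pre_digraph" and H :: "'b pair_pre_digraph"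
  assumes fin: "finite (pverts G)" "finite (pverts H)"
    and left_inverse: "\<And>u v. u \<in> pverts G \<Longrightarrow> v \<in> pverts G \<Longrightarrow>
      (\<Sum>A\<in>pverts H. \<psi> u A * \<phi> A v) = (if u = v then 1 else 0)"
    and intertwining: "\<And>A v. A \<in> pverts H \<Longrightarrow> v \<in> pverts G \<Longrightarrow>
      (\<Sum>B\<in>pverts H. laplacian H A B * \<phi> B v) = (\<Sum>u\<in>pverts G. \<phi> A u * laplacian G u v)"
  shows "laplacian_spectrum G \<subseteq># laplacian_spectrum H"
proof -
  obtain vs where vs: "distinct vs" "set vs = pverts G"
    using finite_distinct_list[OF fin(1)] by blast
  obtain ws where ws: "distinct ws" "set ws = pverts H"
    using finite_distinct_list[OF fin(2)] by blast
  define n N where "n = length vs" and "N = length ws"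
  define M L where "M = mat N N (\<lambda>(i, j). laplacian H (ws ! i) (ws ! j))"
    and "L = mat n n (\<lambda>(i, j). laplacian G (vs ! i) (vs ! j))"
  define B X where "B = mat N n (\<lambda>(i, j). \<phi> (ws ! i) (vs ! j))"
    and "X = mat n N (\<lambda>(i, j). \<psi> (vs ! i) (ws ! j))"
  have mem: "vs ! i \<in> pverts G" if "i < n" for i
    using that vs by (metis n_def nth_mem)
  have mem': "ws ! i \<in> pverts H" if "i < N" for i
    using that ws by (metis N_def nth_mem)
  note reindex = sum_nth_distinct[OF vs(1), unfolded vs(2), folded n_def]
    sum_nth_distinct[OF ws(1), unfolded ws(2), folded N_def]
  have "X * B = 1\<^sub>m n"
  proof (rule eq_matI)
    fix i j assume "i < dim_row (1\<^sub>m n :: complex mat)" "j < dim_col (1\<^sub>m n :: complex mat)"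
    hence ij: "i < n" "j < n" by auto
    hence "(X * B) $$ (i, j) = (\<Sum>k = 0..<N. \<psi> (vs ! i) (ws ! k) * \<phi> (ws ! k) (vs ! j))"
      by (simp add: X_def B_def scalar_prod_def)
    also have "\<dots> = (if vs ! i = vs ! j then 1 else 0)"
      using ij by (simp add: left_inverse mem
          reindex(2)[of "\<lambda>A. \<psi> (vs ! i) A * \<phi> A (vs ! j)"])
    finally show "(X * B) $$ (i, j) = 1\<^sub>m n $$ (i, j)"
      using ij vs by (simp add: nth_eq_iff_index_eq n_def)
  qed (auto simp: X_def B_def)
  moreover have "M * B = B * L"
  proof (rule eq_matI)
    fix i j assume "i < dim_row (B * L)" "j < dim_col (B * L)"
    hence ij: "i < N" "j < n" by (auto simp: B_def L_def)
    hence "(M * B) $$ (i, j) = (\<Sum>k = 0..<N. laplacian H (ws ! i) (ws ! k) * \<phi> (ws ! k) (vs ! j))"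
      by (simp add: M_def B_def scalar_prod_def)
    also have "\<dots> = (\<Sum>u\<in>pverts G. \<phi> (ws ! i) u * laplacian G u (vs ! j))"
      using ij by (simp add: intertwining mem mem'
          reindex(2)[of "\<lambda>A. laplacian H (ws ! i) A * \<phi> A (vs ! j)"])
    also have "\<dots> = (\<Sum>k = 0..<n. \<phi> (ws ! i) (vs ! k) * laplacian G (vs ! k) (vs ! j))"
      by (simp add: reindex(1)[of "\<lambda>u. \<phi> (ws ! i) u * laplacian G u (vs ! j)"])
    also have "\<dots> = (B * L) $$ (i, j)"
      using ij by (simp add: L_def B_def scalar_prod_def)
    finally show "(M * B) $$ (i, j) = (B * L) $$ (i, j)" .
  qed (auto simp: M_def L_def B_def)
  ultimately have "proots (char_poly L) \<subseteq># proots (char_poly M)"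
    by (intro proots_char_poly_subset_of_intertwining[of _ N _ n B X])
      (auto simp: M_def L_def B_def X_def)
  thus ?thesis
    using vs ws by (simp add: laplacian_spectrum_eq[of vs] laplacian_spectrum_eq[of ws]
        mat_spectrum_def map_laplacian_mat M_def L_def n_def N_def)
qed

section \<open>The token graph Laplacian applied to the incidence matrix\<close>

lemma (in pair_graph) arcs_sym: "(u, v) \<in> parcs G \<longleftrightarrow> (v, u) \<in> parcs G"
  using pair_sym_arcs by (auto simp: symmetric_def dest: symD)

lemma (in pair_graph) laplacian_sym: "laplacian G u v = laplacian G v u"
  by (auto simp: laplacian_def arcs_sym)

text \<open>Distributing the degree term over the neighbours leaves differences along edges. These
  are easy to evaluate in the token graph, where a move changes membership at only two
  vertices.\<close>

lemma (in pair_graph) sum_laplacian: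
  assumes u: "u \<in> pverts G"
  shows "(\<Sum>v\<in>pverts G. laplacian G u v * h v) = (\<Sum>w | (u, w) \<in> parcs G. h u - h w)"
proof -
  have "(\<Sum>v\<in>pverts G. laplacian G u v * h v) =
      (\<Sum>v\<in>pverts G. if u = v then of_nat (card {w. (u, w) \<in> parcs G}) * h u else 0)
      - (\<Sum>v\<in>pverts G. if (u, v) \<in> parcs G then h v else 0)"
    by (subst sum_subtractf[symmetric]) (auto intro!: sum.cong simp: laplacian_def algebra_simps)
  also have "(\<Sum>v\<in>pverts G. if (u, v) \<in> parcs G then h v else 0) = (\<Sum>w | (u, w) \<in> parcs G. h w)"
    using wellformed by (subst sum.inter_filter[symmetric]) (force intro!: sum.cong)+
  finally show ?thesis
    using u by (simp add: sum_subtractf)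
qed

text \<open>A neighbour \<open>B\<close> of \<open>A\<close> arises by moving one token from an
  occupied \<open>a\<close> to a free \<open>b\<close>. The move is recovered from \<open>B\<close>,
  since \<open>A - B = {a}\<close> and \<open>B - A = {b}\<close>.\<close>

lemma token_graph_neighbours:
  assumes "pair_graph G" and A: "A \<subseteq> pverts G" "card A = k"
  shows "bij_betw (\<lambda>(a, b). insert b (A - {a})) {(a, b) \<in> parcs G. a \<in> A \<and> b \<notin> A}
    {B. (A, B) \<in> parcs (token_graph k G)}"
proof -
  interpret pair_graph G by fact
  have finA: "finite A" using A pair_finite_verts finite_subset by blast
  show ?thesis
  proof (rule bij_betwI')
    let ?f = "\<lambda>(a, b). insert b (A - {a})"
    fix x y assume xy: "x \<in> {(a, b) \<in> parcs G. a \<in> A \<and> b \<notin> A}"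
      "y \<in> {(a, b) \<in> parcs G. a \<in> A \<and> b \<notin> A}"
    have "A - ?f z = {fst z}" "?f z - A = {snd z}"
      if "z \<in> {(a, b) \<in> parcs G. a \<in> A \<and> b \<notin> A}" for z
      using that by (auto split: prod.splits)
    from this[OF xy(1)] this[OF xy(2)] have "fst x = fst y \<and> snd x = snd y" if "?f x = ?f y"
      unfolding that by simp
    thus "?f x = ?f y \<longleftrightarrow> x = y"
      by (auto simp: prod_eq_iff)
  next
    fix x assume "x \<in> {(a, b) \<in> parcs G. a \<in> A \<and> b \<notin> A}"
    then obtain a b where x: "x = (a, b)" and ab: "(a, b) \<in> parcs G" "a \<in> A" "b \<notin> A"
      by auto
    have "b \<in> pverts G" using ab wellformed by force
    moreover have "card (insert b (A - {a})) = k"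
      using ab finA A card_Suc_Diff1[of A a] by simp
    moreover have "sym_diff A (insert b (A - {a})) = {a, b}" using ab by auto
    ultimately show "(case x of (a, b) \<Rightarrow> insert b (A - {a})) \<in> {B. (A, B) \<in> parcs (token_graph k G)}"
      using A ab x by (auto simp: token_graph_def)
  next
    fix B assume "B \<in> {B. (A, B) \<in> parcs (token_graph k G)}"
    then obtain a b where ab: "a \<in> A" "b \<in> B" "sym_diff A B = {a, b}" "(a, b) \<in> parcs G"
      by (auto simp: token_graph_def)
    have "a \<noteq> b" using ab(4) no_loops by force
    hence "a \<notin> B" "b \<notin> A" "B = insert b (A - {a})" using ab(1-3) by blast+
    thus "\<exists>x\<in>{(a, b) \<in> parcs G. a \<in> A \<and> b \<notin> A}. B = (case x of (a, b) \<Rightarrow> insert b (A - {a}))"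
      using ab by (intro bexI[of _ "(a, b)"]) auto
  qed
qed

lemma sum_laplacian_token_graph:
  fixes \<phi> :: "'a set \<Rightarrow> 'a \<Rightarrow> complex"
  assumes "pair_graph G" and A: "A \<in> pverts (token_graph k G)" and v: "v \<in> pverts G"
  defines "\<phi> \<equiv> \<lambda>A v. of_bool (v \<in> A)"
  shows "(\<Sum>B\<in>pverts (token_graph k G). laplacian (token_graph k G) A B * \<phi> B v) =
    (\<Sum>u\<in>pverts G. \<phi> A u * laplacian G u v)"
proof -
  interpret pair_graph G by fact
  interpret T: pair_graph "token_graph k G" by (rule pair_graph_token_graph) fact
  let ?E = "{(a, b) \<in> parcs G. a \<in> A \<and> b \<notin> A}"
  have A': "A \<subseteq> pverts G" "card A = k" using A by (auto simp: token_graph_def)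
  have "(\<Sum>B\<in>pverts (token_graph k G). laplacian (token_graph k G) A B * \<phi> B v) =
      (\<Sum>B | (A, B) \<in> parcs (token_graph k G). \<phi> A v - \<phi> B v)"
    using A by (rule T.sum_laplacian)
  also have "\<dots> = (\<Sum>(a, b)\<in>?E. \<phi> A v - \<phi> (insert b (A - {a})) v)"
    by (subst sum.reindex_bij_betw[OF token_graph_neighbours[OF assms(1) A'], symmetric])
      (simp add: case_prod_unfold)
  also have "\<dots> = (\<Sum>(a, b)\<in>?E. of_bool (a = v) - of_bool (b = v))"
    by (intro sum.cong) (auto simp: \<phi>_def)
  \<comment> \<open>The weight \<open>\<phi> A a * (1 - \<phi> A b)\<close> is the indicator of
    \<open>?E\<close>, so the sum can run over all arcs, a set closed under reversal.\<close>
  also have "\<dots> = (\<Sum>(a, b)\<in>parcs G. of_bool (a = v) * (\<phi> A a * (1 - \<phi> A b)))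
      - (\<Sum>(a, b)\<in>parcs G. of_bool (b = v) * (\<phi> A a * (1 - \<phi> A b)))"
    by (subst sum_subtractf[symmetric], rule sum.mono_neutral_cong_left)
      (auto simp: \<phi>_def)
  \<comment> \<open>Reversing the arcs of the second sum makes both run over the arcs leaving \<open>v\<close>, where the
    weights differ by \<open>\<phi> A a * (1 - \<phi> A b) - \<phi> A b * (1 - \<phi> A a) = \<phi> A a - \<phi> A b\<close>.\<close>
  also have "(\<Sum>(a, b)\<in>parcs G. of_bool (b = v) * (\<phi> A a * (1 - \<phi> A b))) =
      (\<Sum>(a, b)\<in>parcs G. of_bool (a = v) * (\<phi> A b * (1 - \<phi> A a)))"
    by (rule sum.reindex_bij_witness[of _ prod.swap prod.swap]) (auto simp: arcs_sym)
  also have "(\<Sum>(a, b)\<in>parcs G. of_bool (a = v) * (\<phi> A a * (1 - \<phi> A b))) - \<dots> =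
      (\<Sum>(a, b)\<in>parcs G. of_bool (a = v) * (\<phi> A v - \<phi> A b))"
    by (subst sum_subtractf[symmetric], rule sum.cong) (auto simp: algebra_simps)
  also have "\<dots> = (\<Sum>(a, b)\<in>Pair v ` {w. (v, w) \<in> parcs G}. \<phi> A v - \<phi> A b)"
    by (rule sum.mono_neutral_cong_right) auto
  also have "\<dots> = (\<Sum>w | (v, w) \<in> parcs G. \<phi> A v - \<phi> A w)"
    by (subst sum.reindex) (auto simp: inj_on_def)
  also have "\<dots> = (\<Sum>u\<in>pverts G. \<phi> A u * laplacian G u v)"
    using sum_laplacian[OF v, of "\<phi> A"] by (simp add: laplacian_sym[of v] mult.commute)
  finally show ?thesis .
qed

section \<open>Counting subsets and inverting the incidence matrix\<close>

lemma card_subsets_containing_avoiding: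
  assumes fin: "finite V" and W: "W \<subseteq> V" and v: "v \<in> V - W" and k: "1 \<le> k"
  shows "card {A. A \<subseteq> V \<and> card A = k \<and> v \<in> A \<and> A \<inter> W = {}} =
    (card V - card W - 1) choose (k - 1)"
proof -
  let ?V = "V - W - {v}"
  \<comment> \<open>Deleting \<open>v\<close> leaves a free choice of \<open>k - 1\<close> elements
    outside \<open>W\<close> and \<open>v\<close>. Later, \<open>W = {}\<close> gives the count
    \<open>c\<close> and \<open>W = {u}\<close> the count \<open>d\<close>.\<close>
  have "bij_betw (insert v) {A. A \<subseteq> ?V \<and> card A = k - 1}
      {A. A \<subseteq> V \<and> card A = k \<and> v \<in> A \<and> A \<inter> W = {}}"
  proof (rule bij_betw_byWitness[where f' = "\<lambda>A. A - {v}"])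
    show "insert v ` {A. A \<subseteq> ?V \<and> card A = k - 1}
        \<subseteq> {A. A \<subseteq> V \<and> card A = k \<and> v \<in> A \<and> A \<inter> W = {}}"
    proof safe
      fix A assume A: "A \<subseteq> ?V" "card A = k - 1"
      hence "finite A" "v \<notin> A" using fin finite_subset[of A V] by auto
      thus "card (insert v A) = k" using A k by simp
    qed (use v in auto)
    show "(\<lambda>A. A - {v}) ` {A. A \<subseteq> V \<and> card A = k \<and> v \<in> A \<and> A \<inter> W = {}}
        \<subseteq> {A. A \<subseteq> ?V \<and> card A = k - 1}"
      by auto
  qed (use v in auto)
  hence "card {A. A \<subseteq> V \<and> card A = k \<and> v \<in> A \<and> A \<inter> W = {}} =
      card {A. A \<subseteq> ?V \<and> card A = k - 1}"
    by (simp add: bij_betw_same_card)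
  also have "\<dots> = card ?V choose (k - 1)" using fin by (intro n_subsets) auto
  also have "card ?V = card V - card W - 1"
    using v W fin finite_subset[OF W fin] by (simp add: card_Diff_subset)
  finally show ?thesis .
qed

lemma subset_incidence_left_inverse:
  fixes V :: "'a set" and k :: nat
  assumes fin: "finite V" and k: "1 \<le> k" "k \<le> card V"
    and proper: "k < card V \<or> card V = 1"
  obtains \<alpha> \<beta> :: complex where "\<And>u v. u \<in> V \<Longrightarrow> v \<in> V \<Longrightarrow>
    (\<Sum>A | A \<subseteq> V \<and> card A = k. (if u \<in> A then \<alpha> else \<beta>) * of_bool (v \<in> A)) =
    (if u = v then 1 else 0)"
proof -
  \<comment> \<open>\<open>c\<close> subsets contain a given \<open>v\<close>, and \<open>d\<close> of them avoid a given \<open>u \<noteq> v\<close>; then \<open>\<alpha>\<close> solves the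
    diagonal equation \<open>\<alpha> * c = 1\<close> and \<open>\<beta>\<close> the off-diagonal one \<open>\<alpha> * (c - d) + \<beta> * d = 0\<close>.\<close>
  define c d where "c = (card V - 1) choose (k - 1)" and "d = (card V - 2) choose (k - 1)"
  define \<alpha> \<beta> :: complex where "\<alpha> = 1 / of_nat c"
    and "\<beta> = - \<alpha> * (of_nat c - of_nat d) / of_nat d"
  let ?T = "{A. A \<subseteq> V \<and> card A = k}"
  have finT: "finite ?T" using fin by simp
  have c0: "c \<noteq> 0" using k by (auto simp: c_def)
  have cv: "card {A \<in> ?T. v \<in> A} = c" if "v \<in> V" for v
    using card_subsets_containing_avoiding[OF fin, of "{}" v k] that k by (simp add: c_def conj_ac)
  have dv: "card {A \<in> ?T. v \<in> A \<and> u \<notin> A} = d" if "u \<in> V" "v \<in> V" "u \<noteq> v" for u v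
    using card_subsets_containing_avoiding[OF fin, of "{u}" v k] that k
    by (simp add: d_def conj_ac numeral_2_eq_2)
  have "(\<Sum>A\<in>?T. (if u \<in> A then \<alpha> else \<beta>) * of_bool (v \<in> A)) = (if u = v then 1 else 0)"
    if uv: "u \<in> V" "v \<in> V" for u v
  proof -
    \<comment> \<open>Giving every set containing \<open>v\<close> the weight \<alpha> and
      correcting by \<beta> - \<alpha> on those that miss \<open>u\<close> reduces the sum to the
      two counts.\<close>
    have "(\<Sum>A\<in>?T. (if u \<in> A then \<alpha> else \<beta>) * of_bool (v \<in> A)) =
        (\<Sum>A\<in>?T. \<alpha> * of_bool (v \<in> A) + (\<beta> - \<alpha>) * of_bool (v \<in> A \<and> u \<notin> A))"
      by (intro sum.cong) auto
    also have "\<dots> = \<alpha> * of_nat c + (\<beta> - \<alpha>) * of_nat (card {A \<in> ?T. v \<in> A \<and> u \<notin> A})"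
      using finT uv cv by (simp add: sum.distrib sum_distrib_left[symmetric] sum.If_cases
          of_bool_def Int_def conj_ac)
    also have "\<dots> = (if u = v then 1 else 0)"
    proof (cases "u = v")
      case True
      thus ?thesis using c0 by (simp add: \<alpha>_def)
    next
      case False
      have "card {u, v} \<le> card V" using uv fin by (intro card_mono) auto
      \<comment> \<open>Two distinct vertices force \<open>card V \<ge> 2\<close>, so
        \<open>proper\<close> gives \<open>k < card V\<close>, that is
        \<open>k - 1 \<le> card V - 2\<close>. For \<open>k = card V\<close> no
        \<open>k\<close>-subset would miss \<open>u\<close>.\<close>
      hence "d \<noteq> 0" using k proper False by (auto simp: d_def)
      thus ?thesis using False c0 dv[OF uv False] by (simp add: \<alpha>_def \<beta>_def field_simps)
    qed
    finally show ?thesis .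
  qed
  thus ?thesis using that by blast
qed

theorem theorem3p1:
  fixes G :: "nat pair_pre_digraph" and n k :: nat
  assumes "pair_graph G"
    and "pverts G = {1..n}"
    and "1 \<le> k" and "k \<le> n"
    and "k < n \<or> n = 1"
  shows "laplacian_spectrum G \<subseteq># laplacian_spectrum (token_graph k G)"
proof -
  interpret pair_graph G by fact
  interpret T: pair_graph "token_graph k G" by (rule pair_graph_token_graph) fact
  have "card (pverts G) = n" using assms by simp
  \<comment> \<open>The case \<open>k = n \<ge> 2\<close> is excluded here: the token graph then has
    a single vertex, too few for \<open>n\<close> eigenvalues.\<close>
  then obtain \<alpha> \<beta> :: complex where left_inverse: "\<And>u v. u \<in> pverts G \<Longrightarrow> v \<in> pverts G \<Longrightarrow>
      (\<Sum>A | A \<subseteq> pverts G \<and> card A = k. (if u \<in> A then \<alpha> else \<beta>) * of_bool (v \<in> A)) =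
      (if u = v then 1 else 0)"
    using subset_incidence_left_inverse[of "pverts G" k] assms(3-5) pair_finite_verts by blast
  have verts: "pverts (token_graph k G) = {A. A \<subseteq> pverts G \<and> card A = k}"
    by (simp add: token_graph_def)
  show ?thesis
  proof (rule laplacian_spectrum_subset_of_intertwining)
    show "(\<Sum>A\<in>pverts (token_graph k G). (if u \<in> A then \<alpha> else \<beta>) * of_bool (v \<in> A)) =
        (if u = v then 1 else 0)" if "u \<in> pverts G" "v \<in> pverts G" for u v
      using left_inverse[OF that] by (simp add: verts)
  qed (rule pair_finite_verts T.pair_finite_verts sum_laplacian_token_graph[OF assms(1)]; assumption)+
qed

end
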